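(* Let $n\geq 2$ be an odd integer and $d\geq 1$ an integer. Let $\{B^1,B^2,\ldots,B^m\}$ be a partition of $[n]^d$ into proper, odd bricks. Then $m\geq 3^d$.
   Context: $[n]=\{1,\dots,n\}$. A sub-box of $[n]^d$ is a set $B=B_1\times\cdots\times B_d$ with $B_i\subseteq[n]$; it is proper if $B_i\neq[n]$ for every $i$, and odd if every $|B_i|$ is odd. A brick is a sub-box in which every $B_i$ is an interval of integers $\{a,a+1,\dots,b\}$ with $a\le b$. A partition means the bricks are pairwise disjoint with union $[n]^d$. *)

theory Defs
  imports Main "HOL-Library.FuncSet" "HOL-Library.Disjoint_Sets"
begin

(* A point of [n]^d is an extensional function on {1..d}: its value is undefined outside {1..d}. *)
definition grid :: "nat \<Rightarrow> nat \<Rightarrow> (nat \<Rightarrow> nat) set" where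
  "grid n d = (\<Pi>\<^sub>E i\<in>{1..d}. {1..n})"

(* The following predicates speak about the family of factors S 1, ..., S d of the
   box Pi\<^sub>E {1..d} S.  A nonempty box determines its factors, so for bricks
   and odd boxes they are properties of the box itself. *)

definition sub_box :: "nat \<Rightarrow> nat \<Rightarrow> (nat \<Rightarrow> nat set) \<Rightarrow> bool" where
  "sub_box n d S \<longleftrightarrow> (\<forall>i\<in>{1..d}. S i \<subseteq> {1..n})"

definition proper_box :: "nat \<Rightarrow> nat \<Rightarrow> (nat \<Rightarrow> nat set) \<Rightarrow> bool" where
  "proper_box n d S \<longleftrightarrow> sub_box n d S \<and> (\<forall>i\<in>{1..d}. S i \<noteq> {1..n})"

definition odd_box :: "nat \<Rightarrow> nat \<Rightarrow> (nat \<Rightarrow> nat set) \<Rightarrow> bool" where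
  "odd_box n d S \<longleftrightarrow> sub_box n d S \<and> (\<forall>i\<in>{1..d}. odd (card (S i)))"

definition brick :: "nat \<Rightarrow> nat \<Rightarrow> (nat \<Rightarrow> nat set) \<Rightarrow> bool" where
  "brick n d S \<longleftrightarrow> sub_box n d S \<and> (\<forall>i\<in>{1..d}. \<exists>a b. a \<le> b \<and> S i = {a..b})"

end

theory Submission
  imports Defs
begin

text \<open>
  Let \<open>F 0 = 0\<close>, \<open>F n = 3\<close>, and for \<open>0 < k < n\<close> let \<open>F k\<close> be \<open>1\<close> or \<open>2\<close> according to whether \<open>k\<close> is
  odd or even. If \<open>{a..b}\<close> is a proper interval of odd size, then \<open>a - 1\<close> and \<open>b\<close> have different
  parity and \<open>F b - F (a - 1) = \<plusminus>1\<close>. Hence the increments of \<open>F\<close> form a signed weight on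
  \<open>{1..n}\<close> of total mass \<open>3\<close> that gives every proper odd interval mass \<open>\<plusminus>1\<close>. In the \<open>d\<close>-fold product
  weight the whole grid has mass \<open>3 ^ d\<close> and every proper odd brick has mass \<open>\<plusminus>1\<close>.
\<close>

definition potential :: "nat \<Rightarrow> nat \<Rightarrow> int" where
  "potential n k = (if k = 0 then 0 else if k = n then 3 else if odd k then 1 else 2)"

definition weight :: "nat \<Rightarrow> nat \<Rightarrow> int" where
  "weight n k = potential n k - potential n (k - 1)"

lemma sum_weight:
  assumes "1 \<le> a" "a \<le> b"
  shows "(\<Sum>k=a..b. weight n k) = potential n b - potential n (a - 1)"
  using assms(2,1) by (induction b rule: dec_induct) (auto simp: weight_def)

lemma sum_weight_total:
  assumes "n \<ge> 1"
  shows "(\<Sum>k=1..n. weight n k) = 3"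
  using assms by (simp add: sum_weight potential_def)

lemma abs_sum_weight_proper_odd:
  assumes "odd n" "1 \<le> a" "a \<le> b" "b \<le> n" "{a..b} \<noteq> {1..n}" "odd (card {a..b})"
  shows "\<bar>\<Sum>k=a..b. weight n k\<bar> = 1"
proof -
  \<comment> \<open>The interval has \<open>b - (a - 1)\<close> elements.\<close>
  have "odd b \<longleftrightarrow> even (a - 1)"
    using assms by auto
  moreover have "\<not> (a = 1 \<and> b = n)"
    using assms by auto
  \<comment> \<open>If \<open>a = 1\<close>, then \<open>b\<close> is odd and the difference is 1 -
    0. If \<open>b = n\<close>, then \<open>a - 1\<close> is even and positive, giving 3 - 2.
    Otherwise the values are 1 and 2 in some order.\<close>
  ultimately have "\<bar>potential n b - potential n (a - 1)\<bar> = 1"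
    using assms(1-4) by (auto simp: potential_def)
  then show ?thesis
    using assms by (simp add: sum_weight)
qed

lemma abs_prod_eq_1:
  fixes f :: "'a \<Rightarrow> 'b::linordered_idom"
  assumes "\<And>i. i \<in> I \<Longrightarrow> \<bar>f i\<bar> = 1"
  shows "\<bar>prod f I\<bar> = 1"
  using assms by (induction I rule: infinite_finite_induct) (auto simp: abs_mult)

text \<open>By distributivity the mass of a box is the product of the one-dimensional masses of its
  factors.\<close>

lemma abs_sum_weight_brick:
  assumes "odd n" "brick n d S" "proper_box n d S" "odd_box n d S"
  shows "\<bar>\<Sum>x\<in>Pi\<^sub>E {1..d} S. \<Prod>i=1..d. weight n (x i)\<bar> = 1"
proof -
  have factor: "finite (S i) \<and> \<bar>\<Sum>k\<in>S i. weight n k\<bar> = 1" if i: "i \<in> {1..d}" for i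
  proof -
    obtain a b where ab: "a \<le> b" "S i = {a..b}"
      using assms(2) i unfolding brick_def by blast
    have "{a..b} \<subseteq> {1..n}" "{a..b} \<noteq> {1..n}" "odd (card {a..b})"
      using assms(3,4) i ab(2) unfolding proper_box_def odd_box_def sub_box_def by metis+
    then show ?thesis
      using abs_sum_weight_proper_odd[OF assms(1)] ab by auto
  qed
  have "(\<Sum>x\<in>Pi\<^sub>E {1..d} S. \<Prod>i=1..d. weight n (x i)) = (\<Prod>i=1..d. \<Sum>k\<in>S i. weight n k)"
    using factor by (subst prod_sum_PiE) auto
  moreover have "\<bar>\<Prod>i=1..d. \<Sum>k\<in>S i. weight n k\<bar> = 1"
    using factor by (intro abs_prod_eq_1) blast
  ultimately show ?thesis
    by metis
qed

theorem theorem1p4: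
  fixes n d :: nat and P :: "(nat \<Rightarrow> nat) set set"
  assumes "n \<ge> 2" and "odd n" and "d \<ge> 1"
    and "partition_on (grid n d) P"
    and "\<forall>B\<in>P. \<exists>S. B = Pi\<^sub>E {1..d} S \<and> brick n d S \<and> proper_box n d S \<and> odd_box n d S"
  shows "card P \<ge> 3 ^ d"
proof -
  let ?w = "\<lambda>x. \<Prod>i=1..d. weight n (x i)"
  have fin: "finite (grid n d)"
    unfolding grid_def by (intro finite_PiE) auto
  have "(\<Sum>x\<in>grid n d. ?w x) = (\<Prod>i=1..d. \<Sum>k=1..n. weight n k)"
    unfolding grid_def by (subst prod_sum_PiE) auto
  also have "\<dots> = 3 ^ d"
    using assms(1) sum_weight_total[of n] by simp
  finally have "3 ^ d = (\<Sum>x\<in>grid n d. ?w x)" ..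
  also have "\<dots> = (\<Sum>B\<in>P. \<Sum>x\<in>B. ?w x)"
  proof -
    have "\<forall>B\<in>P. finite B"
      using partition_onD1[OF assms(4)] fin by (metis Union_upper finite_subset)
    from sum.Union_disjoint_sets[OF this, of ?w] show ?thesis
      using partition_onD1[OF assms(4)] partition_onD2[OF assms(4)] by (simp add: comp_def)
  qed
  \<comment> \<open>A brick of mass 1 or -1 adds at most 1 to the total.\<close>
  also have "\<dots> \<le> (\<Sum>B\<in>P. 1)"
  proof (rule sum_mono)
    fix B assume "B \<in> P"
    then obtain S where "B = Pi\<^sub>E {1..d} S" "brick n d S" "proper_box n d S" "odd_box n d S"
      using assms(5) by blast
    with abs_sum_weight_brick[OF assms(2)] show "(\<Sum>x\<in>B. ?w x) \<le> 1"
      by (metis abs_ge_self)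
  qed
  also have "\<dots> = int (card P)"
    by simp
  finally have "int (3 ^ d) \<le> int (card P)"
    by simp
  then show ?thesis
    by linarith
qed

end
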